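(* For $i=1,2$, let $X_i$ be a random variable taking values in a measurable space $\Omega_i$ (with $X_1,X_2$ defined on a common probability space), and let $\varphi_i$ be a measurable function defined on $\Omega_i$ and taking values in a general measurable space. Then, for all $f\in\mathbb F$, $$S_f(\varphi_1(X_1),\varphi_2(X_2))\le S_f(X_1,X_2).$$
   Context: A proper convex function on $\mathbb R$ is a convex function with values in $(-\infty,+\infty]$ finite at some point; $\mathrm{dom}(f)=f^{-1}(\mathbb R)$. $\mathbb F$ is the set of proper convex functions $f$ on $\mathbb R$ with $\mathrm{dom}(f)\subset[0,\infty)$, right continuous at $0$ (i.e. $f(0)=\lim_{t\to0+}f(t)\in(-\infty,+\infty]$), $f(1)=0$, and $1$ in the interior of $\mathrm{dom}(f)$. For $f\in\mathbb F$, $f^*(0):=\lim_{t\to+\infty}f(t)/t$. For probability measures $P,Q$ on the same measurable space, with densities $p,q$ w.r.t. a dominating $\sigma$-finite measure, $\frac{dP}{dQ}:=p/q\in[0,+\infty]$ (convention $0/0=0$), defined $(P+Q)$-a.e., and $$D_f(P\Vert Q)=\int f\left(\frac{dP}{dQ}\right)dQ+f^*(0)\,P\left(\frac{dP}{dQ}=+\infty\right),$$ the last term being $0$ by convention if $P\ll Q$. The Csiszár index is $S_f(X,Y)=D_f(P_X\otimes P_Y\,\Vert\,P_{(X,Y)})$, with $P_Z$ the distribution of $Z$; it may be infinite. *)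

theory Defs
  imports "HOL-Probability.Probability"
begin

section \<open>Proper convex functions and the class F\<close>

definition effective_dom :: "(real \<Rightarrow> ereal) \<Rightarrow> real set" where
  "effective_dom f = {t. \<bar>f t\<bar> \<noteq> \<infinity>}"

text \<open>
  The library's \<^const>\<open>convex_on\<close> is for real-valued functions only. Since the value
  \<open>-\<infinity>\<close> is excluded and \<open>0 * \<infinity> = 0\<close> in \<^typ>\<open>ereal\<close>,
  the right-hand side of the convexity inequality never contains \<open>\<infinity> - \<infinity>\<close>,
  and the inequality is trivial if one of the weights is \<open>0\<close>.
\<close>

definition proper_convex :: "(real \<Rightarrow> ereal) \<Rightarrow> bool" where
  "proper_convex f \<longleftrightarrow>
     (\<forall>t. f t \<noteq> -\<infinity>) \<and>
     effective_dom f \<noteq> {} \<and>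
     (\<forall>x y u v. 0 \<le> u \<longrightarrow> 0 \<le> v \<longrightarrow> u + v = 1 \<longrightarrow>
        f (u * x + v * y) \<le> ereal u * f x + ereal v * f y)"

definition csiszar_class :: "(real \<Rightarrow> ereal) set" where
  "csiszar_class = {f. proper_convex f \<and>
     effective_dom f \<subseteq> {0..} \<and>
     (f \<longlongrightarrow> f 0) (at_right 0) \<and>
     f 1 = 0 \<and>
     1 \<in> interior (effective_dom f)}"

text \<open>The value \<open>f\<^sup>*(0)\<close>, the limit of \<open>f(t)/t\<close> at infinity.\<close>

definition star0 :: "(real \<Rightarrow> ereal) \<Rightarrow> ereal" where
  "star0 f = Lim at_top (\<lambda>t. f t / ereal t)"

section \<open>Divergence\<close>

text \<open>
  Integral of an extended-real function, possibly infinite. It is only meaningful if the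
  positive or the negative part has finite integral; below, the negative part always does,
  as a proper convex function has an affine minorant.
\<close>

definition ereal_integral :: "'a measure \<Rightarrow> ('a \<Rightarrow> ereal) \<Rightarrow> ereal" where
  "ereal_integral M g =
     enn2ereal (\<integral>\<^sup>+ x. e2ennreal (g x) \<partial>M) - enn2ereal (\<integral>\<^sup>+ x. e2ennreal (- g x) \<partial>M)"

text \<open>
  The divergence computed from densities \<open>p\<close>, \<open>q\<close> of \<open>P\<close>, \<open>Q\<close>. In \<^typ>\<open>ennreal\<close> we have
  \<open>x / 0 = \<infinity>\<close> for \<open>x > 0\<close> and \<open>0 / 0 = 0\<close>, so \<open>p x / q x\<close> is \<open>dP/dQ\<close>. It is finite
  \<open>Q\<close>-a.e., so that the value \<^term>\<open>enn2real \<infinity> = 0\<close> does not affect the integral. As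
  \<open>\<infinity> * 0 = 0\<close> in \<^typ>\<open>ereal\<close>, the singular term vanishes if \<open>P\<close> is absolutely
  continuous with respect to \<open>Q\<close>.
\<close>

definition csiszar_div_dens ::
    "(real \<Rightarrow> ereal) \<Rightarrow> 'a measure \<Rightarrow> 'a measure \<Rightarrow> ('a \<Rightarrow> ennreal) \<Rightarrow> ('a \<Rightarrow> ennreal) \<Rightarrow> ereal" where
  "csiszar_div_dens f P Q p q =
     ereal_integral Q (\<lambda>x. f (enn2real (p x / q x))) +
     star0 f * ereal (measure P {x \<in> space P. p x / q x = \<infinity>})"

definition sum_meas :: "'a measure \<Rightarrow> 'a measure \<Rightarrow> 'a measure" where
  "sum_meas P Q = measure_of (space P) (sets P) (\<lambda>A. emeasure P A + emeasure Q A)"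

text \<open>
  The dominating measure is taken to be \<open>P + Q\<close>; \<open>csiszar_div_eq\<close> below shows that
  the choice of the dominating measure and of the densities is irrelevant.
\<close>

definition csiszar_div :: "(real \<Rightarrow> ereal) \<Rightarrow> 'a measure \<Rightarrow> 'a measure \<Rightarrow> ereal" where
  "csiszar_div f P Q =
     csiszar_div_dens f P Q (RN_deriv (sum_meas P Q) P) (RN_deriv (sum_meas P Q) Q)"

definition csiszar_index ::
    "(real \<Rightarrow> ereal) \<Rightarrow> 'w measure \<Rightarrow> 'a measure \<Rightarrow> 'b measure \<Rightarrow> ('w \<Rightarrow> 'a) \<Rightarrow> ('w \<Rightarrow> 'b) \<Rightarrow> ereal" where
  "csiszar_index f M S T X Y =
     csiszar_div f (distr M S X \<Otimes>\<^sub>M distr M T Y) (distr M (S \<Otimes>\<^sub>M T) (\<lambda>w. (X w, Y w)))"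

section \<open>Independence of the dominating measure\<close>

lemma space_sum_meas [simp]: "space (sum_meas P Q) = space P"
  by (simp add: sum_meas_def)

lemma sets_sum_meas [simp, measurable_cong]: "sets (sum_meas P Q) = sets P"
  by (simp add: sum_meas_def)

lemma emeasure_sum_meas:
  assumes "sets Q = sets P" "A \<in> sets P"
  shows "emeasure (sum_meas P Q) A = emeasure P A + emeasure Q A"
proof (rule emeasure_measure_of[OF sum_meas_def])
  show "countably_additive (sets (sum_meas P Q)) (\<lambda>A. emeasure P A + emeasure Q A)"
  proof (rule countably_additiveI)
    fix A :: "nat \<Rightarrow> 'a set"
    assume A: "range A \<subseteq> sets (sum_meas P Q)" "disjoint_family A"
    have "(\<Sum>i. emeasure P (A i) + emeasure Q (A i))
        = (\<Sum>i. emeasure P (A i)) + (\<Sum>i. emeasure Q (A i))"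
      by (rule suminf_add[symmetric]) auto
    then show "(\<Sum>i. emeasure P (A i) + emeasure Q (A i))
        = emeasure P (\<Union>i. A i) + emeasure Q (\<Union>i. A i)"
      using A assms(1) by (simp add: suminf_emeasure)
  qed
qed (use assms sets.space_closed[of P] in \<open>auto simp: positive_def\<close>)

lemma csiszar_div_dens_cong_AE:
  assumes P: "AE x in P. p x / q x = p' x / q' x"
    and Q: "AE x in Q. p x / q x = p' x / q' x"
    and [measurable]: "p \<in> borel_measurable P" "q \<in> borel_measurable P"
      "p' \<in> borel_measurable P" "q' \<in> borel_measurable P"
  shows "csiszar_div_dens f P Q p q = csiszar_div_dens f P Q p' q'"
proof -
  have "measure P {x \<in> space P. p x / q x = \<infinity>} = measure P {x \<in> space P. p' x / q' x = \<infinity>}"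
    using P by (intro measure_eq_AE) auto
  moreover have "(\<integral>\<^sup>+ x. e2ennreal (f (enn2real (p x / q x))) \<partial>Q)
      = (\<integral>\<^sup>+ x. e2ennreal (f (enn2real (p' x / q' x))) \<partial>Q)"
    using Q by (intro nn_integral_cong_AE) auto
  moreover have "(\<integral>\<^sup>+ x. e2ennreal (- f (enn2real (p x / q x))) \<partial>Q)
      = (\<integral>\<^sup>+ x. e2ennreal (- f (enn2real (p' x / q' x))) \<partial>Q)"
    using Q by (intro nn_integral_cong_AE) auto
  ultimately show ?thesis
    by (simp add: csiszar_div_dens_def ereal_integral_def)
qed

theorem csiszar_div_eq:
  assumes "sigma_finite_measure \<mu>" "prob_space P" "prob_space Q"
    and p: "p \<in> borel_measurable \<mu>" "density \<mu> p = P"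
    and q: "q \<in> borel_measurable \<mu>" "density \<mu> q = Q"
  shows "csiszar_div f P Q = csiszar_div_dens f P Q p q"
proof -
  interpret \<mu>: sigma_finite_measure \<mu> by fact
  interpret P: prob_space P by fact
  interpret Q: prob_space Q by fact
  note [measurable] = p(1) q(1)
  have sP [measurable_cong]: "sets P = sets \<mu>" and sQ [measurable_cong]: "sets Q = sets \<mu>"
    using p q by auto
  define \<nu> where "\<nu> = sum_meas P Q"
  define d where "d = (\<lambda>x. p x + q x)"
  have d [measurable]: "d \<in> borel_measurable \<mu>"
    by (simp add: d_def)
  have s\<nu> [measurable_cong]: "sets \<nu> = sets \<mu>"
    by (simp add: \<nu>_def sP)
  have em: "emeasure \<nu> A = emeasure P A + emeasure Q A" if "A \<in> sets \<mu>" for A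
    unfolding \<nu>_def using that sP sQ by (intro emeasure_sum_meas) auto
  have \<nu>: "\<nu> = density \<mu> d"
  proof (rule measure_eqI)
    fix A assume "A \<in> sets \<nu>"
    then have A [measurable]: "A \<in> sets \<mu>" by (simp add: s\<nu>)
    have "emeasure \<nu> A = emeasure (density \<mu> p) A + emeasure (density \<mu> q) A"
      using em[OF A] p q by simp
    also have "\<dots> = emeasure (density \<mu> d) A"
      by (simp add: emeasure_density d_def distrib_right nn_integral_add)
    finally show "emeasure \<nu> A = emeasure (density \<mu> d) A" .
  qed (simp add: s\<nu>)
  have "finite_measure \<nu>"
  proof
    have "emeasure \<nu> (space \<nu>) = emeasure P (space \<mu>) + emeasure Q (space \<mu>)"
      using em[of "space \<mu>"] sets_eq_imp_space_eq[OF s\<nu>] by simp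
    then show "emeasure \<nu> (space \<nu>) \<noteq> \<infinity>"
      by simp
  qed
  then interpret \<nu>: finite_measure \<nu> .
  define r where "r = RN_deriv \<nu> P"
  define s where "s = RN_deriv \<nu> Q"
  have r [measurable]: "r \<in> borel_measurable \<mu>" and s [measurable]: "s \<in> borel_measurable \<mu>"
    using borel_measurable_RN_deriv[of \<nu> P] borel_measurable_RN_deriv[of \<nu> Q]
    by (auto simp: r_def s_def measurable_cong_sets[OF s\<nu> refl])
  have acP: "absolutely_continuous \<nu> P" and acQ: "absolutely_continuous \<nu> Q"
    using em by (auto simp: absolutely_continuous_def null_sets_def sP sQ s\<nu>)
  have rP: "density \<nu> r = P" and sQ': "density \<nu> s = Q"
    unfolding r_def s_def
    by (intro \<nu>.density_RN_deriv acP acQ; simp add: sP sQ s\<nu>)+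
  have "density \<mu> (\<lambda>x. d x * r x) = density \<mu> p"
    using rP p by (simp add: \<nu> density_density_eq)
  then have 1: "AE x in \<mu>. d x * r x = p x"
    by (intro \<mu>.density_unique) auto
  have "density \<mu> (\<lambda>x. d x * s x) = density \<mu> q"
    using sQ' q by (simp add: \<nu> density_density_eq)
  then have 2: "AE x in \<mu>. d x * s x = q x"
    by (intro \<mu>.density_unique) auto
  have "(\<integral>\<^sup>+ x. d x \<partial>\<mu>) = emeasure \<nu> (space \<nu>)"
    unfolding \<nu> by (simp add: emeasure_density cong: nn_integral_cong)
  then have "(\<integral>\<^sup>+ x. d x \<partial>\<mu>) \<noteq> \<infinity>"
    using \<nu>.emeasure_finite by simp
  then have 3: "AE x in \<mu>. d x \<noteq> \<infinity>"
    by (intro nn_integral_PInf_AE) auto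
  have "AE x in \<mu>. 0 < d x \<longrightarrow> r x / s x = p x / q x"
    using 1 2 3
  proof eventually_elim
    case (elim x)
    then show ?case
      by (metis divide_mult_eq mult.commute zero_order(5))
  qed
  then have AE\<nu>: "AE x in \<nu>. r x / s x = p x / q x"
    unfolding \<nu> by (simp add: AE_density)
  then have "AE x in P. r x / s x = p x / q x" "AE x in Q. r x / s x = p x / q x"
    using absolutely_continuous_AE[OF _ acP AE\<nu>] absolutely_continuous_AE[OF _ acQ AE\<nu>]
    by (auto simp: sP sQ s\<nu>)
  then show ?thesis
    unfolding csiszar_div_def \<nu>_def[symmetric] r_def[symmetric] s_def[symmetric]
    by (intro csiszar_div_dens_cong_AE) auto
qed

end

theory Submission
  imports Defs
begin

text \<open>
  Both measures in the index of \<open>(\<phi>1(X1), \<phi>2(X2))\<close> are images under \<open>\<phi>1 \<times> \<phi>2\<close> of the measures in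
  the index of \<open>(X1, X2)\<close>, so the theorem is an instance of the data processing inequality
  \<open>csiszar_div_distr_le\<close>: a measurable map does not increase a divergence.

  To see the latter, write \<open>D_f(P, Q)\<close> as an integral \<open>\<integral> F(p, q) d\<mu>\<close> over a dominating measure, where
  \<open>F(p, q) = q f(p / q)\<close> is the perspective of \<open>f\<close>, extended by \<open>F(p, 0) = p f\<^sup>*(0)\<close>. Subtracting a
  multiple of \<open>t - 1\<close> from \<open>f\<close> does not change the divergence, so \<open>f\<close> may be assumed nonnegative.
  If \<open>f\<close> is lower semicontinuous, it is the supremum of its affine minorants \<open>a t + b\<close>, of which
  countably many suffice, and \<open>f\<^sup>*(0)\<close> is the supremum of their slopes; so \<open>F(p, q)\<close> is
  the supremum of the linear functions \<open>a p + b q\<close>. By monotone convergence, \<open>D_f(P, Q)\<close> is the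
  supremum of the numbers \<open>\<integral> a(k) dP + \<integral> b(k) dQ\<close> over measurable selections \<open>k\<close> with finitely many values.
  A selection \<open>k\<close> for the images of \<open>P\<close> and \<open>Q\<close> under \<open>\<phi>\<close> yields the same number as the selection
  \<open>k \<circ> \<phi>\<close> for \<open>P\<close> and \<open>Q\<close>, whence the inequality (\<open>nn_integral_persp_sup_le\<close>).

  A function of the class can fail to be lower semicontinuous, but only by jumping upwards at a
  positive endpoint \<open>e\<close> of its domain (\<open>persp_sup_affine_minorants_eq\<close>, \<open>finite_jump_points\<close>). Such a
  jump contributes its height times the \<open>Q\<close>-measure of \<open>{p = e q}\<close>. If \<open>D_f(P, Q)\<close> is finite, then
  \<open>p - e q\<close> has constant sign, and therefore vanishes almost everywhere on every set \<open>A\<close> with \<open>P(A) = e Q(A)\<close>, in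
  particular on the preimage of the set where the density ratio of the images equals \<open>e\<close>. So
  the jump contributes no more after applying the map than before (\<open>nn_integral_jump_le\<close>).
\<close>

section \<open>Affine minorants of convex functions\<close>

text \<open>
  Only the half-line \<open>[0, \<infinity>)\<close> counts, since likelihood ratios are nonnegative. Lowering either
  coefficient therefore lowers the affine function, which makes rational coefficients sufficient.
\<close>

definition affine_minorants :: "(real \<Rightarrow> ereal) \<Rightarrow> (real \<times> real) set" where
  "affine_minorants f = {(a, b). \<forall>t\<ge>0. ereal (a * t + b) \<le> f t}"

lemma csiszar_class_convexD:
  assumes "f \<in> csiszar_class" "0 \<le> u" "0 \<le> v" "u + v = 1"
  shows "f (u * x + v * y) \<le> ereal u * f x + ereal v * f y"
  using assms by (auto simp: csiszar_class_def proper_convex_def)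

lemma csiszar_class_not_MInf: "f \<in> csiszar_class \<Longrightarrow> f t \<noteq> -\<infinity>"
  by (auto simp: csiszar_class_def proper_convex_def)

lemma csiszar_class_at_1:
  assumes "f \<in> csiszar_class"
  shows "f 1 = 0" "1 \<in> effective_dom f" "1 \<in> interior (effective_dom f)"
  using assms by (auto simp: csiszar_class_def effective_dom_def)

lemma csiszar_class_outside_dom:
  assumes "f \<in> csiszar_class" "t \<notin> effective_dom f"
  shows "f t = \<infinity>"
  using csiszar_class_not_MInf[OF assms(1), of t] assms(2) by (auto simp: effective_dom_def)

lemma effective_dom_eq_ereal:
  assumes "t \<in> effective_dom f"
  shows "f t = ereal (real_of_ereal (f t))"
  using assms by (auto simp: effective_dom_def ereal_real)

lemma convex_on_effective_dom:
  assumes "f \<in> csiszar_class"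
  shows "convex_on (effective_dom f) (\<lambda>t. real_of_ereal (f t))"
proof -
  have *: "f (u * x + v * y) \<le> ereal (u * real_of_ereal (f x) + v * real_of_ereal (f y))"
    if "x \<in> effective_dom f" "y \<in> effective_dom f" "0 \<le> u" "0 \<le> v" "u + v = 1" for x y u v
    using csiszar_class_convexD[OF assms that(3-5), of x y]
      effective_dom_eq_ereal[OF that(1)] effective_dom_eq_ereal[OF that(2)]
    by (metis plus_ereal.simps(1) times_ereal.simps(1))
  have dom: "u * x + v * y \<in> effective_dom f"
    if "x \<in> effective_dom f" "y \<in> effective_dom f" "0 \<le> u" "0 \<le> v" "u + v = 1" for x y u v
    using *[OF that] csiszar_class_not_MInf[OF assms, of "u * x + v * y"]
    by (auto simp: effective_dom_def)
  show ?thesis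
    unfolding convex_on_def convex_def
  proof (intro conjI ballI allI impI)
    fix x y u v :: real
    assume h: "x \<in> effective_dom f" "y \<in> effective_dom f" "0 \<le> u" "0 \<le> v" "u + v = 1"
    show "u *\<^sub>R x + v *\<^sub>R y \<in> effective_dom f"
      using dom[OF h] by simp
    show "real_of_ereal (f (u *\<^sub>R x + v *\<^sub>R y))
        \<le> u * real_of_ereal (f x) + v * real_of_ereal (f y)"
      using *[OF h] effective_dom_eq_ereal[OF dom[OF h]]
      by (metis ereal_less_eq(3) real_scaleR_def)
  qed
qed

lemma interval_effective_dom: "f \<in> csiszar_class \<Longrightarrow> is_interval (effective_dom f)"
  using convex_on_effective_dom by (auto simp: is_interval_convex_1 convex_on_def)

text \<open>
  A tangent at an interior point of the domain, in a form that needs no case distinction on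
  whether \<open>f s\<close> is finite. The tangent at \<open>1\<close> is what later reduces the theorem to \<open>f \<ge> 0\<close>.
\<close>

lemma csiszar_class_subgradient:
  assumes f: "f \<in> csiszar_class" and t: "t \<in> interior (effective_dom f)"
  shows "\<exists>a. \<forall>s. f t + ereal (a * (s - t)) \<le> f s"
proof -
  define a where "a = Inf ((\<lambda>s. (real_of_ereal (f t) - real_of_ereal (f s)) / (t - s))
      ` ({t<..} \<inter> effective_dom f))"
  have ft: "f t = ereal (real_of_ereal (f t))"
    using t interior_subset effective_dom_eq_ereal by blast
  have "f t + ereal (a * (s - t)) \<le> f s" for s
  proof (cases "s \<in> effective_dom f")
    case True
    have "real_of_ereal (f t) + a * (s - t) \<le> real_of_ereal (f s)"
      unfolding a_def by (rule convex_le_Inf_differential[OF convex_on_effective_dom[OF f] t True])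
    then have "ereal (real_of_ereal (f t)) + ereal (a * (s - t)) \<le> ereal (real_of_ereal (f s))"
      by simp
    then show ?thesis
      using ft effective_dom_eq_ereal[OF True] by simp
  qed (use csiszar_class_outside_dom[OF f] in simp)
  then show ?thesis by blast
qed

text \<open>
  The domain is an interval, so a point with domain on both sides of it is interior. For a
  boundary point \<open>e\<close>, this turns finiteness of the divergence into the one-sided bound
  \<open>p \<le> e q\<close> or \<open>p \<ge> e q\<close>.
\<close>

lemma effective_dom_one_sided:
  assumes "f \<in> csiszar_class" "t \<notin> interior (effective_dom f)"
  shows "effective_dom f \<subseteq> {..t} \<or> effective_dom f \<subseteq> {t..}"
proof (rule ccontr)
  assume "\<not> ?thesis"
  then obtain u v where uv: "u \<in> effective_dom f" "v \<in> effective_dom f" "u < t" "t < v"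
    by (auto simp: not_le subset_eq)
  have "{u<..<v} \<subseteq> effective_dom f"
    using interval_effective_dom[OF assms(1)] uv unfolding is_interval_1 by fastforce
  then have "{u<..<v} \<subseteq> interior (effective_dom f)"
    by (intro interior_maximal) auto
  then show False
    using assms(2) uv by auto
qed

text \<open>
  Supporting lines exist at interior points of the domain. At \<open>0\<close> there may be none (as for
  \<open>t ln t\<close>), but right continuity keeps \<open>f\<close> above \<open>y\<close> near \<open>0\<close>, and a sufficiently steep
  descending line starting at \<open>y\<close> is below \<open>0 \<le> f\<close> from there on. At positive distance from the
  domain, a steep line that is positive only on the side of \<open>t\<close> works. The other points, the
  positive endpoints of the domain, are excluded for a reason: \<open>f\<close> may jump upwards there.
\<close>

lemma affine_minorant_approx:
  assumes f: "f \<in> csiszar_class" and nonneg: "\<And>s. 0 \<le> f s" and "0 \<le> t"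
    and t: "t \<in> interior (effective_dom f) \<or> t = 0 \<or> t \<notin> closure (effective_dom f)"
    and y: "ereal y < f t"
  shows "\<exists>(a, b) \<in> affine_minorants f. y \<le> a * t + b"
  using t
proof (elim disjE)
  assume t: "t \<in> interior (effective_dom f)"
  then obtain a where a: "\<And>s. f t + ereal (a * (s - t)) \<le> f s"
    using csiszar_class_subgradient[OF f] by blast
  define z where "z = real_of_ereal (f t)"
  have z: "f t = ereal z"
    using t interior_subset effective_dom_eq_ereal unfolding z_def by blast
  have "(a, z - a * t) \<in> affine_minorants f"
    using a by (auto simp: affine_minorants_def z algebra_simps)
  then show ?thesis
    using y z by (intro bexI[of _ "(a, z - a * t)"]) auto
next
  assume t: "t = 0"
  have "(f \<longlongrightarrow> f 0) (at_right 0)"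
    using f by (simp add: csiszar_class_def)
  then have "eventually (\<lambda>s. ereal y < f s) (at_right 0)"
    using y t by (simp add: order_tendstoD)
  then obtain d where d: "0 < d" "\<And>s. 0 < s \<Longrightarrow> s < d \<Longrightarrow> ereal y < f s"
    unfolding eventually_at_right_field by auto
  have "ereal (- (\<bar>y\<bar> / d) * s + y) \<le> f s" if "0 \<le> s" for s
  proof (cases "s < d")
    case True
    have "ereal (- (\<bar>y\<bar> / d) * s + y) \<le> ereal y"
      using that d(1) by simp
    also have "\<dots> \<le> f s"
      using that True d(2)[of s] y t by (cases "s = 0") auto
    finally show ?thesis .
  next
    case False
    then have "\<bar>y\<bar> * d \<le> \<bar>y\<bar> * s"
      by (intro mult_left_mono) auto
    then have "\<bar>y\<bar> \<le> \<bar>y\<bar> / d * s"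
      using d(1) by (simp add: field_simps)
    then have "ereal (- (\<bar>y\<bar> / d) * s + y) \<le> 0"
      by (simp add: zero_ereal_def del: ereal_less_eq) simp
    then show ?thesis
      using nonneg[of s] by (rule order_trans)
  qed
  then have "(- (\<bar>y\<bar> / d), y) \<in> affine_minorants f"
    by (simp add: affine_minorants_def)
  then show ?thesis
    using t by (intro bexI[of _ "(- (\<bar>y\<bar> / d), y)"]) auto
next
  assume "t \<notin> closure (effective_dom f)"
  then have "open (- closure (effective_dom f))" "t \<in> - closure (effective_dom f)"
    by auto
  then obtain e where e: "0 < e" "ball t e \<subseteq> - closure (effective_dom f)"
    by (meson openE)
  have e2: "s \<notin> effective_dom f" if "\<bar>t - s\<bar> < e" for s
    using that e(2) closure_subset by (fastforce simp: dist_real_def)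
  have far: "e \<le> \<bar>t - 1\<bar>"
    using e2[of 1] csiszar_class_at_1(2)[OF f] by linarith
  note int = interval_effective_dom[OF f, unfolded is_interval_1, rule_format]
  \<comment> \<open>The line vanishes halfway between \<open>t\<close> and the nearest possible point of the domain; its
    slope is chosen so that it has climbed to at least \<open>y\<close> at \<open>t\<close>.\<close>
  define K where "K = 2 * \<bar>y\<bar> / e"
  have K: "0 \<le> K" "y \<le> K * (e / 2)"
    using e(1) by (auto simp: K_def)
  show ?thesis
  proof (cases "1 < t")
    case True
    have "f s = \<infinity>" if "t - e / 2 < s" for s
    proof (rule csiszar_class_outside_dom[OF f] notI)+
      assume "s \<in> effective_dom f"
      then have "t - e / 2 \<in> effective_dom f"
        using int[of 1 s "t - e / 2"] csiszar_class_at_1[OF f] far True that e(1) by auto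
      then show False
        using e2[of "t - e / 2"] e(1) by auto
    qed
    moreover have "ereal (K * (s - (t - e / 2))) \<le> f s" if "s \<le> t - e / 2" for s
      using that K(1) nonneg[of s]
      by (intro order_trans[OF _ nonneg]) (simp add: mult_nonneg_nonpos)
    ultimately have "ereal (K * (s - (t - e / 2))) \<le> f s" for s
      by (cases "t - e / 2 < s") auto
    then have "(K, - K * (t - e / 2)) \<in> affine_minorants f"
      by (simp add: affine_minorants_def algebra_simps)
    then show ?thesis
      using K by (intro bexI[of _ "(K, - K * (t - e / 2))"]) (auto simp: algebra_simps)
  next
    case False
    have "f s = \<infinity>" if "s < t + e / 2" for s
    proof (rule csiszar_class_outside_dom[OF f] notI)+
      assume "s \<in> effective_dom f"
      then have "t + e / 2 \<in> effective_dom f"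
        using int[of s 1 "t + e / 2"] csiszar_class_at_1[OF f] far False that e(1) by auto
      then show False
        using e2[of "t + e / 2"] e(1) by auto
    qed
    moreover have "ereal (K * ((t + e / 2) - s)) \<le> f s" if "s \<ge> t + e / 2" for s
      using that K(1) nonneg[of s]
      by (intro order_trans[OF _ nonneg]) (simp add: mult_nonneg_nonpos)
    ultimately have "ereal (K * ((t + e / 2) - s)) \<le> f s" for s
      by (cases "s < t + e / 2") auto
    then have "(- K, K * (t + e / 2)) \<in> affine_minorants f"
      by (simp add: affine_minorants_def algebra_simps)
    then show ?thesis
      using K by (intro bexI[of _ "(- K, K * (t + e / 2))"]) (auto simp: algebra_simps)
  qed
qed

text \<open>
  The limit that defines \<open>f\<^sup>*(0)\<close> exists and is the supremum of the slopes of affine minorants.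
  Minorants bound the quotient from below in the limit. Conversely, since \<open>f 1 = 0\<close>, convexity
  makes \<open>f t / (t - 1)\<close> nondecreasing on \<open>(1, \<infinity>)\<close>; if it ever reaches \<open>r\<close>, it stays at least \<open>r\<close>,
  and then a line of slope \<open>r\<close> lies below \<open>f\<close>. Hence values of \<open>f t / (t - 1)\<close> above the supremum
  of the slopes are impossible.
\<close>

lemma tendsto_slope_at_top:
  assumes f: "f \<in> csiszar_class" and nonneg: "\<And>s. 0 \<le> f s"
  shows "((\<lambda>t. f t / ereal t) \<longlongrightarrow> (SUP (a, b) \<in> affine_minorants f. ereal a)) at_top"
    (is "(_ \<longlongrightarrow> ?L) _")
proof (rule order_tendstoI)
  fix y assume "y < ?L"
  then obtain a b where ab: "(a, b) \<in> affine_minorants f" "y < ereal a"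
    by (auto simp: less_SUP_iff)
  have "((\<lambda>t. a + b / t) \<longlongrightarrow> a + 0) at_top"
    by (intro tendsto_intros tendsto_divide_0[OF tendsto_const] filterlim_at_top_imp_at_infinity
        filterlim_ident)
  then have "((\<lambda>t. ereal (a + b / t)) \<longlongrightarrow> ereal a) at_top"
    by simp
  then have "eventually (\<lambda>t. y < ereal (a + b / t)) at_top"
    using ab(2) by (rule order_tendstoD)
  then show "eventually (\<lambda>t. y < f t / ereal t) at_top"
    using eventually_gt_at_top[of "0::real"]
  proof eventually_elim
    case (elim t)
    have "ereal (a + b / t) = ereal (a * t + b) / ereal t"
      using elim(2) by (simp add: field_simps)
    also have "\<dots> \<le> f t / ereal t"
      using ab(1) elim(2) by (intro ereal_divide_right_mono) (auto simp: affine_minorants_def)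
    finally show ?case
      using elim(1) by simp
  qed
next
  fix y assume y: "?L < y"
  have "(0, 0) \<in> affine_minorants f"
    using nonneg by (simp add: affine_minorants_def zero_ereal_def[symmetric])
  then have L0: "0 \<le> ?L"
    by (intro SUP_upper2[of "(0, 0)"]) auto
  obtain r where r: "?L < ereal r" "ereal r < y"
    using ereal_dense2[OF y] by auto
  have r0: "0 < r"
    using L0 r(1) by (metis ereal_less(2) order_le_less_trans)
  have "f t < ereal (r * (t - 1))" if "1 < t" for t
  proof (rule ccontr)
    assume "\<not> f t < ereal (r * (t - 1))"
    then have ft: "ereal (r * (t - 1)) \<le> f t"
      by simp
    have "ereal (r * (s - t)) \<le> f s" for s
    proof (cases "t < s")
      case True
      \<comment> \<open>The weight that expresses \<open>t\<close> as a convex combination of \<open>1\<close> and \<open>s\<close>.\<close>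
      define v where "v = (t - 1) / (s - 1)"
      have v: "0 < v" "v \<le> 1" "v * (s - 1) = t - 1"
        using True that by (auto simp: v_def)
      have "f t = f ((1 - v) * 1 + v * s)"
        using v(3) by (simp add: algebra_simps)
      also have "\<dots> \<le> ereal (1 - v) * f 1 + ereal v * f s"
        using v by (intro csiszar_class_convexD[OF f]) auto
      also have "\<dots> = ereal v * f s"
        using csiszar_class_at_1[OF f] by simp
      finally have "ereal (r * (t - 1)) \<le> ereal v * f s"
        using ft by simp
      then have "ereal v * ereal (r * (s - 1)) \<le> ereal v * f s"
        using v(3) by (simp add: mult.left_commute)
      then have "ereal (r * (s - 1)) \<le> f s"
        using v(1) by (cases "f s") auto
      moreover have "r * (s - t) \<le> r * (s - 1)"
        using r0 that by (intro mult_left_mono) auto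
      ultimately show ?thesis
        by (meson ereal_less_eq(3) order_trans)
    next
      case False
      then have "ereal (r * (s - t)) \<le> 0"
        using r0 by (simp add: mult_nonneg_nonpos)
      then show ?thesis
        using nonneg[of s] by (rule order_trans)
    qed
    then have "(r, - r * t) \<in> affine_minorants f"
      by (simp add: affine_minorants_def algebra_simps)
    then have "ereal r \<le> ?L"
      by (intro SUP_upper2[of "(r, - r * t)"]) auto
    then show False
      using r(1) by simp
  qed
  then have "f t / ereal t < y" if "1 < t" for t
  proof -
    have "f t / ereal t \<le> ereal (r * (t - 1)) / ereal t"
      using that \<open>\<And>t. 1 < t \<Longrightarrow> f t < ereal (r * (t - 1))\<close>[OF that]
      by (intro ereal_divide_right_mono) auto
    also have "\<dots> \<le> ereal r"
      using that r0 by (simp add: field_simps)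
    finally show ?thesis
      using r(2) by simp
  qed
  then show "eventually (\<lambda>t. f t / ereal t < y) at_top"
    by (intro eventually_mono[OF eventually_gt_at_top[of "1::real"]])
qed

lemma star0_nonneg_eq:
  assumes "f \<in> csiszar_class" "\<And>s. 0 \<le> f s"
  shows "star0 f = (SUP (a, b) \<in> affine_minorants f. ereal a)"
  unfolding star0_def using tendsto_slope_at_top[OF assms] by (intro tendsto_Lim) auto

section \<open>Suprema of affine minorants and the points of jump\<close>

definition rational_minorants :: "(real \<Rightarrow> ereal) \<Rightarrow> (real \<times> real) set" where
  "rational_minorants f = affine_minorants f \<inter> \<rat> \<times> \<rat>"

text \<open>
  The homogeneous form in two variables treats the regular part (\<open>q > 0\<close>) and the singular part
  (\<open>q = 0\<close>) of a pair of measures alike. The coercion \<^const>\<open>ennreal\<close> truncates negative values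
  to \<open>0\<close>, which changes nothing as soon as the zero function is among the minorants.
\<close>

definition persp_sup :: "(real \<times> real) set \<Rightarrow> real \<Rightarrow> real \<Rightarrow> ennreal" where
  "persp_sup S p q = (SUP (a, b) \<in> S. ennreal (a * p + b * q))"

lemma countable_rational_minorants: "countable (rational_minorants f)"
  unfolding rational_minorants_def
  by (intro countable_Int2 countable_SIGMA countable_rat)

text \<open>
  Both coefficients may be decreased to rational ones, at a cost of at most \<open>d (p + q)\<close>. The
  point is countability: it allows monotone convergence over finite subfamilies.
\<close>

lemma persp_sup_rational_minorants:
  assumes "0 \<le> p" "0 \<le> q"
  shows "persp_sup (rational_minorants f) p q = persp_sup (affine_minorants f) p q"
proof (rule antisym)
  show "persp_sup (rational_minorants f) p q \<le> persp_sup (affine_minorants f) p q"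
    unfolding persp_sup_def rational_minorants_def by (intro SUP_subset_mono) auto
  show "persp_sup (affine_minorants f) p q \<le> persp_sup (rational_minorants f) p q"
    unfolding persp_sup_def
  proof (rule SUP_least, clarify)
    fix a b assume ab: "(a, b) \<in> affine_minorants f"
    show "ennreal (a * p + b * q) \<le> (SUP (a, b) \<in> rational_minorants f. ennreal (a * p + b * q))"
      (is "_ \<le> ?S")
    proof (rule ennreal_le_epsilon)
      fix e :: real assume e: "0 < e"
      define d where "d = e / (p + q + 1)"
      have d: "0 < d" "d * (p + q) \<le> e"
        using e assms by (auto simp: d_def field_simps)
      obtain a' where a': "a' \<in> \<rat>" "a - d < a'" "a' < a"
        using Rats_dense_in_real[of "a - d" a] d by auto
      obtain b' where b': "b' \<in> \<rat>" "b - d < b'" "b' < b"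
        using Rats_dense_in_real[of "b - d" b] d by auto
      have "ereal (a' * t + b') \<le> f t" if "0 \<le> t" for t
      proof -
        have "a' * t + b' \<le> a * t + b"
          using a' b' that by (intro add_mono mult_right_mono) auto
        then have "ereal (a' * t + b') \<le> ereal (a * t + b)"
          by simp
        also have "\<dots> \<le> f t"
          using ab that by (auto simp: affine_minorants_def)
        finally show ?thesis .
      qed
      then have "(a', b') \<in> rational_minorants f"
        using a' b' by (auto simp: rational_minorants_def affine_minorants_def)
      then have S: "ennreal (a' * p + b' * q) \<le> ?S"
        by (intro SUP_upper2[of "(a', b')"]) auto
      have "a * p + b * q \<le> (a' + d) * p + (b' + d) * q"
        using a' b' assms by (intro add_mono mult_right_mono) auto
      also have "\<dots> = a' * p + b' * q + d * (p + q)"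
        by (simp add: algebra_simps)
      also have "\<dots> \<le> max 0 (a' * p + b' * q) + e"
        using d by (intro add_mono) auto
      finally have "ennreal (a * p + b * q) \<le> ennreal (max 0 (a' * p + b' * q) + e)"
        by (rule ennreal_leI)
      also have "\<dots> = ennreal (a' * p + b' * q) + ennreal e"
        using e by (subst ennreal_plus) (auto simp: max_def ennreal_neg)
      also have "\<dots> \<le> ?S + ennreal e"
        using S by (rule add_right_mono)
      finally show "ennreal (a * p + b * q) \<le> ?S + ennreal e" .
    qed
  qed
qed

lemma persp_sup_homogeneous:
  assumes "0 < q"
  shows "persp_sup S p q = ennreal q * persp_sup S (p / q) 1"
  unfolding persp_sup_def SUP_mult_left_ennreal
proof (intro SUP_cong refl, clarify)
  fix a b :: real
  have "a * p + b * q = q * (a * (p / q) + b * 1)"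
    using assms by (simp add: field_simps)
  then show "ennreal (a * p + b * q) = ennreal q * ennreal (a * (p / q) + b * 1)"
    using assms by (simp add: ennreal_mult')
qed

lemma persp_sup_affine_minorants_le:
  assumes "0 \<le> t"
  shows "persp_sup (affine_minorants f) t 1 \<le> e2ennreal (f t)"
  unfolding persp_sup_def
proof (rule SUP_least, clarify)
  fix a b assume "(a, b) \<in> affine_minorants f"
  then have "ereal (a * t + b) \<le> f t"
    using assms by (auto simp: affine_minorants_def)
  then have "e2ennreal (ereal (a * t + b)) \<le> e2ennreal (f t)"
    by (rule e2ennreal_mono)
  then show "ennreal (a * t + b * 1) \<le> e2ennreal (f t)"
    by simp
qed

lemma persp_sup_affine_minorants_eq:
  assumes f: "f \<in> csiszar_class" and nonneg: "\<And>s. 0 \<le> f s" and t: "0 \<le> t"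
    "t \<in> interior (effective_dom f) \<or> t = 0 \<or> t \<notin> closure (effective_dom f)"
  shows "persp_sup (affine_minorants f) t 1 = e2ennreal (f t)"
proof (rule antisym[OF persp_sup_affine_minorants_le[OF t(1)]], rule dense_le)
  fix z assume z: "z < e2ennreal (f t)"
  then have "z < top"
    using top_greatest by (rule less_le_trans)
  then obtain y where y: "z = ennreal y" "0 \<le> y"
    by (cases z rule: ennreal_cases) auto
  have "enn2ereal z < f t"
    using z nonneg[of t] by (simp add: less_ennreal.rep_eq enn2ereal_e2ennreal)
  then have "ereal y < f t"
    using y by (simp add: enn2ereal_ennreal)
  then obtain a b where "(a, b) \<in> affine_minorants f" "y \<le> a * t + b"
    using affine_minorant_approx[OF f nonneg t] by blast
  then show "z \<le> persp_sup (affine_minorants f) t 1"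
    unfolding persp_sup_def y by (intro SUP_upper2[of "(a, b)"]) (auto intro: ennreal_leI)
qed

text \<open>
  On the singular part, the supremum over the minorants is exactly what the divergence
  assigns to the mass of \<open>P\<close> that is singular to \<open>Q\<close>.
\<close>

lemma persp_sup_affine_minorants_at_0:
  assumes f: "f \<in> csiszar_class" and nonneg: "\<And>s. 0 \<le> f s" and p: "0 \<le> p"
  shows "persp_sup (affine_minorants f) p 0 = ennreal p * e2ennreal (star0 f)"
proof -
  have "(0, 0) \<in> affine_minorants f"
    using nonneg by (simp add: affine_minorants_def zero_ereal_def[symmetric])
  then have star0: "0 \<le> star0 f"
    unfolding star0_nonneg_eq[OF f nonneg] by (intro SUP_upper2[of "(0, 0)"]) auto
  have "e2ennreal (star0 f) = (SUP (a, b) \<in> affine_minorants f. ennreal a)" (is "_ = ?R")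
  proof (rule antisym)
    show "e2ennreal (star0 f) \<le> ?R"
    proof (rule dense_le)
      fix z assume "z < e2ennreal (star0 f)"
      then have "enn2ereal z < star0 f"
        using star0 by (simp add: less_ennreal.rep_eq enn2ereal_e2ennreal)
      then obtain a b where ab: "(a, b) \<in> affine_minorants f" "enn2ereal z < ereal a"
        unfolding star0_nonneg_eq[OF f nonneg] by (auto simp: less_SUP_iff)
      have "z \<le> ennreal a"
        using e2ennreal_mono[OF less_imp_le[OF ab(2)]] by simp
      then show "z \<le> ?R"
        using ab(1) by (intro SUP_upper2[of "(a, b)"]) auto
    qed
    show "?R \<le> e2ennreal (star0 f)"
    proof (rule SUP_least, clarify)
      fix a b assume "(a, b) \<in> affine_minorants f"
      then have "ereal a \<le> star0 f"
        unfolding star0_nonneg_eq[OF f nonneg] by (intro SUP_upper2[of "(a, b)"]) auto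
      then show "ennreal a \<le> e2ennreal (star0 f)"
        using e2ennreal_mono by fastforce
    qed
  qed
  then show ?thesis
    unfolding persp_sup_def using p
    by (auto simp: SUP_mult_left_ennreal ennreal_mult'' mult.commute intro!: SUP_cong)
qed

text \<open>
  The points where \<open>f\<close> is not the supremum of its affine minorants, that is, not lower
  semicontinuous. For \<open>f\<close> in the class, only positive endpoints of the domain can have this property.
\<close>

definition jump_points :: "(real \<Rightarrow> ereal) \<Rightarrow> real set" where
  "jump_points f = {t. 0 \<le> t \<and> persp_sup (affine_minorants f) t 1 \<noteq> e2ennreal (f t)}"

lemma jump_points_one_sided:
  assumes f: "f \<in> csiszar_class" and nonneg: "\<And>s. 0 \<le> f s" and "e \<in> jump_points f"
  shows "0 < e" "effective_dom f \<subseteq> {..e} \<or> effective_dom f \<subseteq> {e..}"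
    "e \<in> closure (effective_dom f)"
  using persp_sup_affine_minorants_eq[OF f nonneg, of e] assms(3) effective_dom_one_sided[OF f, of e]
  by (auto simp: jump_points_def order_less_le)

lemma finite_jump_points:
  assumes f: "f \<in> csiszar_class" and nonneg: "\<And>s. 0 \<le> f s"
  shows "finite (jump_points f)"
proof -
  let ?D = "effective_dom f"
  have ne: "?D \<noteq> {}"
    using csiszar_class_at_1[OF f] by auto
  have "jump_points f \<subseteq> {Sup ?D, Inf ?D}"
  proof
    fix e assume "e \<in> jump_points f"
    note e = jump_points_one_sided[OF f nonneg this]
    from e(2) show "e \<in> {Sup ?D, Inf ?D}"
    proof
      assume D: "?D \<subseteq> {..e}"
      have "?D \<subseteq> {..Sup ?D}"
        using D by (auto intro!: cSup_upper bdd_aboveI)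
      then have "e \<le> Sup ?D"
        using e(3) closure_minimal[of ?D "{..Sup ?D}"] by auto
      moreover have "Sup ?D \<le> e"
        using D ne by (intro cSup_least) auto
      ultimately show ?thesis by auto
    next
      assume D: "?D \<subseteq> {e..}"
      have "?D \<subseteq> {Inf ?D..}"
        using D by (auto intro!: cInf_lower bdd_belowI)
      then have "Inf ?D \<le> e"
        using e(3) closure_minimal[of ?D "{Inf ?D..}"] by auto
      moreover have "e \<le> Inf ?D"
        using D ne by (intro cInf_greatest) auto
      ultimately show ?thesis by auto
    qed
  qed
  then show ?thesis
    by (rule finite_subset) auto
qed

text \<open>
  Sublevel sets of a convex function are intervals.
\<close>

lemma borel_measurable_csiszar_class:
  assumes f: "f \<in> csiszar_class"
  shows "f \<in> borel_measurable borel"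
proof (rule borel_measurableI_le)
  fix y
  have "is_interval {t. f t \<le> y}"
    unfolding is_interval_convex_1 convex_def
  proof (intro ballI allI impI)
    fix s t u v :: real
    assume h: "s \<in> {t. f t \<le> y}" "t \<in> {t. f t \<le> y}" "0 \<le> u" "0 \<le> v" "u + v = 1"
    have "f (u * s + v * t) \<le> ereal u * f s + ereal v * f t"
      using h by (intro csiszar_class_convexD[OF f])
    also have "\<dots> \<le> ereal u * y + ereal v * y"
      using h by (intro add_mono ereal_mult_left_mono) auto
    also have "\<dots> = y"
      using h by (simp add: ereal_left_distrib[symmetric])
    finally show "u *\<^sub>R s + v *\<^sub>R t \<in> {t. f t \<le> y}"
      by simp
  qed
  then show "{t \<in> space borel. f t \<le> y} \<in> sets borel"
    using real_interval_borel_measurable by simp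
qed

section \<open>Densities of a pair of probability measures\<close>

text \<open>
  Real-valued densities, so that the ratio \<open>p / q\<close> can be computed in the reals. Where \<open>q\<close>
  vanishes it is \<open>0\<close>, harmlessly, because that set is \<open>Q\<close>-null.
\<close>

locale prob_densities =
  P: prob_space P + Q: prob_space Q + sigma_finite_measure \<mu>
  for \<mu> P Q :: "'a measure" +
  fixes p q :: "'a \<Rightarrow> real"
  assumes p_measurable [measurable]: "p \<in> borel_measurable \<mu>"
    and q_measurable [measurable]: "q \<in> borel_measurable \<mu>"
    and p_nonneg: "\<And>x. 0 \<le> p x" and q_nonneg: "\<And>x. 0 \<le> q x"
    and P_eq: "density \<mu> (\<lambda>x. ennreal (p x)) = P"
    and Q_eq: "density \<mu> (\<lambda>x. ennreal (q x)) = Q"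
begin

lemma sets_P [measurable_cong]: "sets P = sets \<mu>" and sets_Q [measurable_cong]: "sets Q = sets \<mu>"
  using P_eq Q_eq by auto

lemma space_P: "space P = space \<mu>" and space_Q: "space Q = space \<mu>"
  using sets_P sets_Q by (auto dest: sets_eq_imp_space_eq)

lemma nn_integral_Q:
  assumes [measurable]: "g \<in> borel_measurable \<mu>"
  shows "(\<integral>\<^sup>+x. g x \<partial>Q) = (\<integral>\<^sup>+x. ennreal (q x) * g x \<partial>\<mu>)"
  unfolding Q_eq[symmetric] by (rule nn_integral_density) auto

lemma AE_Q_pos: "AE x in Q. 0 < q x"
  unfolding Q_eq[symmetric] by (subst AE_density) auto

text \<open>
  This is how a choice of minorants at each point, with coefficients \<open>u\<close> and \<open>v\<close>, is integrated:
  the left-hand side mentions only the measures, so it can be transported along a map.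
\<close>

lemma integral_sum_eq:
  fixes u v :: "'a \<Rightarrow> real"
  assumes [measurable]: "u \<in> borel_measurable \<mu>" "v \<in> borel_measurable \<mu>"
    and bounded: "\<And>x. \<bar>u x\<bar> \<le> B" "\<And>x. \<bar>v x\<bar> \<le> B"
  shows "integrable \<mu> (\<lambda>x. u x * p x + v x * q x)"
    and "(\<integral>x. u x \<partial>P) + (\<integral>x. v x \<partial>Q) = (\<integral>x. u x * p x + v x * q x \<partial>\<mu>)"
proof -
  have "integrable P u" "integrable Q v"
    using bounded by (auto intro!: P.integrable_const_bound[where B = B] Q.integrable_const_bound[where B = B])
  then have i: "integrable \<mu> (\<lambda>x. p x * u x)" "integrable \<mu> (\<lambda>x. q x * v x)"
    unfolding P_eq[symmetric] Q_eq[symmetric]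
    by (auto simp: integrable_real_density p_nonneg q_nonneg)
  then show "integrable \<mu> (\<lambda>x. u x * p x + v x * q x)"
    by (simp add: mult.commute)
  have "(\<integral>x. u x \<partial>P) = (\<integral>x. p x * u x \<partial>\<mu>)" "(\<integral>x. v x \<partial>Q) = (\<integral>x. q x * v x \<partial>\<mu>)"
    unfolding P_eq[symmetric] Q_eq[symmetric]
    by (auto simp: integral_real_density p_nonneg q_nonneg)
  then show "(\<integral>x. u x \<partial>P) + (\<integral>x. v x \<partial>Q) = (\<integral>x. u x * p x + v x * q x \<partial>\<mu>)"
    using i by (simp add: mult.commute)
qed

end

lemma prob_densities_exist:
  assumes "prob_space P" "prob_space Q" "sets Q = sets P"
  obtains \<mu> p q where "prob_densities \<mu> P Q p q"
proof -
  interpret P: prob_space P by fact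
  interpret Q: prob_space Q by fact
  define \<mu> where "\<mu> = sum_meas P Q"
  have s [measurable_cong]: "sets \<mu> = sets P"
    by (simp add: \<mu>_def)
  have em: "emeasure \<mu> A = emeasure P A + emeasure Q A" if "A \<in> sets P" for A
    unfolding \<mu>_def using that assms(3) by (intro emeasure_sum_meas) auto
  have "finite_measure \<mu>"
    by (rule finite_measureI) (simp add: em sets_eq_imp_space_eq[OF s] )
  then interpret \<mu>: finite_measure \<mu> .
  have ac: "absolutely_continuous \<mu> P" "absolutely_continuous \<mu> Q"
    using em assms(3) by (auto simp: absolutely_continuous_def null_sets_def s)
  obtain p where p: "p \<in> borel_measurable \<mu>" "AE x in \<mu>. RN_deriv \<mu> P x = ennreal (p x)"
      "\<And>x. 0 \<le> p x"
    using \<mu>.real_RN_deriv[of P] ac s P.finite_measure_axioms by metis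
  obtain q where q: "q \<in> borel_measurable \<mu>" "AE x in \<mu>. RN_deriv \<mu> Q x = ennreal (q x)"
      "\<And>x. 0 \<le> q x"
    using \<mu>.real_RN_deriv[of Q] ac s assms(3) Q.finite_measure_axioms by metis
  have "density \<mu> (\<lambda>x. ennreal (p x)) = density \<mu> (RN_deriv \<mu> P)"
    using p by (intro density_cong) auto
  moreover have "density \<mu> (\<lambda>x. ennreal (q x)) = density \<mu> (RN_deriv \<mu> Q)"
    using q by (intro density_cong) auto
  ultimately have "prob_densities \<mu> P Q p q"
    using p q ac s assms(3)
    by (unfold_locales) (auto simp: \<mu>.density_RN_deriv)
  then show ?thesis by (rule that)
qed

section \<open>Monotonicity for suprema of linear functions\<close>

text \<open>
  Only the measures \<open>P\<close> and \<open>Q\<close> are transported along \<open>\<phi>\<close>; each side has its own dominating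
  measure and its own densities.
\<close>

locale pushed_densities =
  dom: prob_densities \<mu> P Q p q + img: prob_densities \<mu>' "distr P N \<phi>" "distr Q N \<phi>" p' q'
  for \<mu> P Q :: "'a measure" and p q and \<mu>' N :: "'b measure" and \<phi> p' q' +
  assumes \<phi>_measurable_P: "\<phi> \<in> measurable P N"
begin

lemma \<phi>_measurable [measurable]: "\<phi> \<in> measurable \<mu> N"
  using \<phi>_measurable_P by (simp add: measurable_cong_sets[OF dom.sets_P refl])

lemma sets_img [measurable_cong]: "sets \<mu>' = sets N"
  using img.sets_P by simp

text \<open>
  For finitely many linear functions, let \<open>k\<close> select one that is maximal at the given point of
  the image space. The integral of the maximum is then linear in the two image measures, with
  bounded integrands, and hence equals the integral on the original space of the linear functions selected
  by \<open>k \<circ> \<phi>\<close>. There the selection is merely admissible, so its integral is at most that of the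
  supremum.
\<close>

lemma nn_integral_persp_sup_finite_le:
  fixes c :: "nat \<Rightarrow> real \<times> real"
  assumes c0: "c 0 = (0, 0)" and c: "range c \<subseteq> S"
  shows "(\<integral>\<^sup>+y. persp_sup (c ` {..n}) (p' y) (q' y) \<partial>\<mu>') \<le> (\<integral>\<^sup>+x. persp_sup S (p x) (q x) \<partial>\<mu>)"
proof -
  define V where "V i y = fst (c i) * p' y + snd (c i) * q' y" for i y
  have [measurable]: "V i \<in> borel_measurable \<mu>'" for i
    unfolding V_def by measurable
  \<comment> \<open>Taking the least maximising index makes the selection measurable.\<close>
  define k where "k y = (LEAST i. i \<le> n \<and> (\<forall>j\<in>{..n}. V j y \<le> V i y))" for y
  have k_measurable [measurable]: "k \<in> measurable \<mu>' (count_space UNIV)"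
    unfolding k_def by measurable
  have k: "k y \<le> n \<and> (\<forall>j\<in>{..n}. V j y \<le> V (k y) y)" for y
  proof -
    have "Max ((\<lambda>i. V i y) ` {..n}) \<in> (\<lambda>i. V i y) ` {..n}"
      by (intro Max_in) auto
    then obtain i where i: "Max ((\<lambda>i. V i y) ` {..n}) = V i y" "i \<in> {..n}"
      by (rule imageE)
    have "V j y \<le> V i y" if "j \<in> {..n}" for j
      unfolding i(1)[symmetric] using that by (intro Max_ge) auto
    then have "i \<le> n \<and> (\<forall>j\<in>{..n}. V j y \<le> V i y)"
      using i(2) by auto
    then show ?thesis
      unfolding k_def by (rule LeastI)
  qed
  define u where "u y = fst (c (k y))" for y
  define v where "v y = snd (c (k y))" for y
  define B where "B = (\<Sum>i\<le>n. \<bar>fst (c i)\<bar> + \<bar>snd (c i)\<bar>)"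
  have [measurable]: "u \<in> borel_measurable \<mu>'"
    unfolding u_def using measurable_compose[OF k_measurable, of "\<lambda>i. fst (c i)"] by simp
  have [measurable]: "v \<in> borel_measurable \<mu>'"
    unfolding v_def using measurable_compose[OF k_measurable, of "\<lambda>i. snd (c i)"] by simp
  have "\<bar>fst (c (k y))\<bar> + \<bar>snd (c (k y))\<bar> \<le> B" for y
    unfolding B_def using k[of y] by (intro member_le_sum) auto
  then have B: "\<bar>u y\<bar> \<le> B" "\<bar>v y\<bar> \<le> B" for y
    unfolding u_def v_def by (smt (verit, ccfv_threshold))+
  note img = img.integral_sum_eq[of u v B, OF _ _ B, simplified]
  have Vk: "V (k y) y = u y * p' y + v y * q' y" for y
    by (simp add: V_def u_def v_def)
  have Vk0: "0 \<le> V (k y) y" for y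
    using k[of y] by (auto simp: V_def c0 dest!: bspec[of _ _ 0])
  have "persp_sup (c ` {..n}) (p' y) (q' y) \<le> ennreal (V (k y) y)" for y
    unfolding persp_sup_def using k[of y]
    by (intro SUP_least) (auto simp: V_def split_beta intro!: ennreal_leI)
  then have "(\<integral>\<^sup>+y. persp_sup (c ` {..n}) (p' y) (q' y) \<partial>\<mu>') \<le> (\<integral>\<^sup>+y. ennreal (V (k y) y) \<partial>\<mu>')"
    by (intro nn_integral_mono)
  also have "\<dots> = ennreal (\<integral>y. V (k y) y \<partial>\<mu>')"
    using Vk0 img(1) by (intro nn_integral_eq_integral) (auto simp: Vk)
  also have "(\<integral>y. V (k y) y \<partial>\<mu>') = (\<integral>y. u y \<partial>distr P N \<phi>) + (\<integral>y. v y \<partial>distr Q N \<phi>)"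
    using img(2) by (simp add: Vk)
  also have "\<dots> = (\<integral>x. u (\<phi> x) \<partial>P) + (\<integral>x. v (\<phi> x) \<partial>Q)"
    by (subst (1 2) integral_distr) auto
  also have "\<dots> = (\<integral>x. u (\<phi> x) * p x + v (\<phi> x) * q x \<partial>\<mu>)"
    by (rule dom.integral_sum_eq(2)[where B = B]) (auto simp: B)
  also have "ennreal \<dots> \<le> ennreal (\<integral>x. max 0 (u (\<phi> x) * p x + v (\<phi> x) * q x) \<partial>\<mu>)"
    using dom.integral_sum_eq(1)[of "\<lambda>x. u (\<phi> x)" "\<lambda>x. v (\<phi> x)" B] B
    by (intro ennreal_leI integral_mono) auto
  also have "\<dots> = (\<integral>\<^sup>+x. ennreal (max 0 (u (\<phi> x) * p x + v (\<phi> x) * q x)) \<partial>\<mu>)"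
    using dom.integral_sum_eq(1)[of "\<lambda>x. u (\<phi> x)" "\<lambda>x. v (\<phi> x)" B] B
    by (intro nn_integral_eq_integral[symmetric]) auto
  also have "\<dots> \<le> (\<integral>\<^sup>+x. persp_sup S (p x) (q x) \<partial>\<mu>)"
  proof (rule nn_integral_mono)
    fix x
    have "c (k (\<phi> x)) \<in> S"
      using c by auto
    then have "ennreal (u (\<phi> x) * p x + v (\<phi> x) * q x) \<le> persp_sup S (p x) (q x)"
      unfolding persp_sup_def u_def v_def
      by (intro SUP_upper2[of "c (k (\<phi> x))"]) (auto simp: split_beta)
    then show "ennreal (max 0 (u (\<phi> x) * p x + v (\<phi> x) * q x)) \<le> persp_sup S (p x) (q x)"
      by (simp add: max_def ennreal_neg split: if_splits)
  qed
  finally show ?thesis .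
qed

lemma nn_integral_persp_sup_le:
  assumes S: "countable S" "(0, 0) \<in> S"
  shows "(\<integral>\<^sup>+y. persp_sup S (p' y) (q' y) \<partial>\<mu>') \<le> (\<integral>\<^sup>+x. persp_sup S (p x) (q x) \<partial>\<mu>)"
proof -
  define c where "c i = (case i of 0 \<Rightarrow> (0, 0) | Suc j \<Rightarrow> from_nat_into S j)" for i
  have c0: "c 0 = (0, 0)"
    by (simp add: c_def)
  have c: "range c = S"
  proof -
    have "range c = insert (c 0) (range (\<lambda>j. c (Suc j)))"
      by (metis UNIV_nat_eq image_insert image_image)
    also have "\<dots> = insert (0, 0) (range (from_nat_into S))"
      by (simp add: c_def)
    also have "\<dots> = S"
      using S range_from_nat_into[of S] by (metis empty_iff insert_absorb)
    finally show ?thesis .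
  qed
  have "persp_sup S a b = (SUP n. persp_sup (c ` {..n}) a b)" for a b
  proof -
    have "S = (\<Union>n. c ` {..n})"
      using c by auto
    then show ?thesis
      unfolding persp_sup_def by (simp only: SUP_UNION)
  qed
  then have "(\<integral>\<^sup>+y. persp_sup S (p' y) (q' y) \<partial>\<mu>') = (\<integral>\<^sup>+y. (SUP n. persp_sup (c ` {..n}) (p' y) (q' y)) \<partial>\<mu>')"
    by simp
  also have "\<dots> = (SUP n. \<integral>\<^sup>+y. persp_sup (c ` {..n}) (p' y) (q' y) \<partial>\<mu>')"
  proof (rule nn_integral_monotone_convergence_SUP)
    show "incseq (\<lambda>n y. persp_sup (c ` {..n}) (p' y) (q' y))"
      unfolding persp_sup_def by (auto simp: incseq_def le_fun_def intro!: SUP_subset_mono)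
    show "(\<lambda>y. persp_sup (c ` {..n}) (p' y) (q' y)) \<in> borel_measurable \<mu>'" for n
      unfolding persp_sup_def split_beta by measurable
  qed
  also have "\<dots> \<le> (\<integral>\<^sup>+x. persp_sup S (p x) (q x) \<partial>\<mu>)"
    using c0 c by (intro SUP_least nn_integral_persp_sup_finite_le) auto
  finally show ?thesis .
qed

end

section \<open>The divergence as the integral of a perspective function\<close>

text \<open>
  What \<open>f\<close> has in addition to the supremum of its affine minorants.
  The difference is taken only at jump points, because \<open>\<infinity> - \<infinity> = \<infinity>\<close> in \<^typ>\<open>ennreal\<close>.
\<close>

definition jump :: "(real \<Rightarrow> ereal) \<Rightarrow> real \<Rightarrow> ennreal" where
  "jump f t = (if t \<in> jump_points f then e2ennreal (f t) - persp_sup (affine_minorants f) t 1 else 0)"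

definition perspective :: "(real \<Rightarrow> ereal) \<Rightarrow> real \<Rightarrow> real \<Rightarrow> ennreal" where
  "perspective f p q =
     (if q = 0 then ennreal p * e2ennreal (star0 f) else ennreal q * e2ennreal (f (p / q)))"

lemma borel_measurable_jump:
  assumes "f \<in> csiszar_class" "\<And>s. 0 \<le> f s"
  shows "jump f \<in> borel_measurable borel"
proof (rule measurable_discrete_difference[of "\<lambda>_. 0"])
  show "countable (jump_points f)"
    using finite_jump_points[OF assms] by (rule countable_finite)
qed (auto simp: jump_def)

lemma perspective_eq:
  assumes f: "f \<in> csiszar_class" and nonneg: "\<And>s. 0 \<le> f s" and pq: "0 \<le> p" "0 \<le> q"
  shows "perspective f p q = persp_sup (rational_minorants f) p q + ennreal q * jump f (p / q)"
proof (cases "q = 0")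
  case True
  then show ?thesis
    using persp_sup_affine_minorants_at_0[OF f nonneg pq(1)] persp_sup_rational_minorants[OF pq]
    by (simp add: perspective_def)
next
  case False
  then have q: "0 < q"
    using pq by simp
  have t: "0 \<le> p / q"
    using pq by simp
  have "e2ennreal (f (p / q)) = persp_sup (affine_minorants f) (p / q) 1 + jump f (p / q)"
    using persp_sup_affine_minorants_le[OF t, of f] t
    by (auto simp: jump_def jump_points_def intro!: add_diff_inverse_ennreal[symmetric])
  then show ?thesis
    using q persp_sup_rational_minorants[OF pq] persp_sup_homogeneous[OF q]
    by (simp add: perspective_def distrib_left)
qed

lemma star0_eq_PInf:
  assumes "\<And>t. e < t \<Longrightarrow> f t = \<infinity>"
  shows "star0 f = \<infinity>"
proof -
  have "((\<lambda>t. f t / ereal t) \<longlongrightarrow> \<infinity>) at_top"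
  proof (rule tendsto_eventually)
    show "eventually (\<lambda>t. f t / ereal t = \<infinity>) at_top"
      using eventually_gt_at_top[of "max e 0"] by eventually_elim (auto simp: assms)
  qed
  then show ?thesis
    unfolding star0_def by (intro tendsto_Lim) auto
qed

context prob_densities
begin

lemma csiszar_div_eq_real_ratio:
  "csiszar_div f P Q = ereal_integral Q (\<lambda>x. f (p x / q x)) +
     star0 f * ereal (measure P {x \<in> space P. q x = 0})"
proof -
  have 1: "enn2real (ennreal (p x) / ennreal (q x)) = p x / q x" for x
    using p_nonneg[of x] q_nonneg[of x]
    by (cases "q x = 0"; cases "p x = 0") (auto simp: divide_ennreal ennreal_divide_zero)
  have "AE x in P. 0 < p x"
    unfolding P_eq[symmetric] by (subst AE_density) auto
  then have "measure P {x \<in> space P. ennreal (p x) / ennreal (q x) = \<infinity>}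
      = measure P {x \<in> space P. q x = 0}"
    using p_nonneg q_nonneg
    by (intro measure_eq_AE) (auto elim!: eventually_mono simp: ennreal_divide_eq_top_iff order_less_le)
  moreover have "csiszar_div f P Q
      = csiszar_div_dens f P Q (\<lambda>x. ennreal (p x)) (\<lambda>x. ennreal (q x))"
    by (intro csiszar_div_eq[of \<mu>] P_eq Q_eq) (unfold_locales, auto)
  ultimately show ?thesis
    by (simp add: csiszar_div_dens_def 1)
qed

text \<open>
  For \<open>f \<ge> 0\<close> both terms of the divergence are integrals of nonnegative functions over disjoint
  sets, so they combine into one.
\<close>

lemma csiszar_div_eq_perspective:
  assumes f: "f \<in> csiszar_class" and nonneg: "\<And>s. 0 \<le> f s" and star0: "0 \<le> star0 f"
  shows "csiszar_div f P Q = enn2ereal (\<integral>\<^sup>+x. perspective f (p x) (q x) \<partial>\<mu>)"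
proof -
  note [measurable] = borel_measurable_csiszar_class[OF f]
  let ?Z = "{x \<in> space \<mu>. q x = 0}"
  have "e2ennreal (- f s) = 0" for s
    using nonneg[of s] by (intro e2ennreal_neg) simp
  then have 1: "ereal_integral Q (\<lambda>x. f (p x / q x))
      = enn2ereal (\<integral>\<^sup>+x. ennreal (q x) * e2ennreal (f (p x / q x)) \<partial>\<mu>)"
    by (simp add: ereal_integral_def nn_integral_Q zero_ennreal.rep_eq)
  have "ennreal (measure P ?Z) = emeasure P ?Z"
    by (simp add: P.emeasure_eq_measure)
  also have "\<dots> = (\<integral>\<^sup>+x. ennreal (p x) * indicator ?Z x \<partial>\<mu>)"
    unfolding P_eq[symmetric] by (rule emeasure_density) auto
  finally have "e2ennreal (star0 f) * ennreal (measure P ?Z)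
      = (\<integral>\<^sup>+x. e2ennreal (star0 f) * (ennreal (p x) * indicator ?Z x) \<partial>\<mu>)"
    by (simp add: nn_integral_cmult)
  moreover have "star0 f * ereal (measure P ?Z)
      = enn2ereal (e2ennreal (star0 f) * ennreal (measure P ?Z))"
    using star0 by (simp add: times_ennreal.rep_eq enn2ereal_e2ennreal)
  ultimately have 2: "star0 f * ereal (measure P {x \<in> space P. q x = 0})
      = enn2ereal (\<integral>\<^sup>+x. e2ennreal (star0 f) * (ennreal (p x) * indicator ?Z x) \<partial>\<mu>)"
    by (simp add: space_P)
  have "csiszar_div f P Q = enn2ereal ((\<integral>\<^sup>+x. ennreal (q x) * e2ennreal (f (p x / q x)) \<partial>\<mu>) +
      (\<integral>\<^sup>+x. e2ennreal (star0 f) * (ennreal (p x) * indicator ?Z x) \<partial>\<mu>))"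
    unfolding csiszar_div_eq_real_ratio 1 2 by (simp add: plus_ennreal.rep_eq)
  also have "(\<integral>\<^sup>+x. ennreal (q x) * e2ennreal (f (p x / q x)) \<partial>\<mu>) +
      (\<integral>\<^sup>+x. e2ennreal (star0 f) * (ennreal (p x) * indicator ?Z x) \<partial>\<mu>)
      = (\<integral>\<^sup>+x. ennreal (q x) * e2ennreal (f (p x / q x)) +
           e2ennreal (star0 f) * (ennreal (p x) * indicator ?Z x) \<partial>\<mu>)"
    by (rule nn_integral_add[symmetric]) auto
  also have "\<dots> = (\<integral>\<^sup>+x. perspective f (p x) (q x) \<partial>\<mu>)"
    by (intro nn_integral_cong) (auto simp: perspective_def indicator_def mult.commute)
  finally show ?thesis .
qed

text \<open>
  A finite divergence forces \<open>p / q\<close> into the domain where \<open>q > 0\<close>. If the domain is bounded above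
  then \<open>f\<^sup>*(0) = \<infinity>\<close>, so that \<open>p\<close> must also vanish where \<open>q\<close> does; if it is bounded below by \<open>e\<close>,
  the claim is trivial there.
\<close>

lemma AE_ratio_one_sided:
  assumes f: "f \<in> csiszar_class" and star0: "0 \<le> star0 f"
    and e: "0 < e" "effective_dom f \<subseteq> {..e} \<or> effective_dom f \<subseteq> {e..}"
    and finite: "(\<integral>\<^sup>+x. perspective f (p x) (q x) \<partial>\<mu>) < \<infinity>"
  shows "(AE x in \<mu>. p x \<le> e * q x) \<or> (AE x in \<mu>. e * q x \<le> p x)"
proof -
  note [measurable] = borel_measurable_csiszar_class[OF f]
  have "AE x in \<mu>. perspective f (p x) (q x) \<noteq> \<infinity>"
    using finite by (intro nn_integral_PInf_AE) (auto simp: perspective_def)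
  then have dom: "AE x in \<mu>. (0 < q x \<longrightarrow> p x / q x \<in> effective_dom f) \<and> (q x = 0 \<longrightarrow> p x = 0 \<or> star0 f \<noteq> \<infinity>)"
  proof eventually_elim
    case (elim x)
    then show ?case
      using csiszar_class_outside_dom[OF f, of "p x / q x"] p_nonneg[of x]
      by (cases "p x / q x \<in> effective_dom f")
        (auto simp: perspective_def ennreal_mult_eq_top_iff split: if_splits)
  qed
  from e(2) show ?thesis
  proof
    assume D: "effective_dom f \<subseteq> {..e}"
    then have inf: "star0 f = \<infinity>"
      using csiszar_class_outside_dom[OF f] by (intro star0_eq_PInf[of e]) fastforce
    from dom have "AE x in \<mu>. p x \<le> e * q x"
    proof eventually_elim
      case (elim x)
      then show ?case
        using D inf q_nonneg[of x] by (cases "q x = 0") (auto simp: field_simps order_less_le)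
    qed
    then show ?thesis ..
  next
    assume D: "effective_dom f \<subseteq> {e..}"
    from dom have "AE x in \<mu>. e * q x \<le> p x"
    proof eventually_elim
      case (elim x)
      then show ?case
        using D q_nonneg[of x] p_nonneg[of x]
        by (cases "q x = 0") (auto simp: field_simps order_less_le)
    qed
    then show ?thesis ..
  qed
qed

text \<open>
  On \<open>A\<close> the function \<open>p - e q\<close> has integral \<open>0\<close>. A function of constant sign with integral \<open>0\<close> vanishes almost everywhere.
\<close>

lemma AE_ratio_eq_of_one_sided:
  assumes side: "(AE x in \<mu>. p x \<le> e * q x) \<or> (AE x in \<mu>. e * q x \<le> p x)"
    and [measurable]: "A \<in> sets \<mu>" and A: "measure P A = e * measure Q A"
  shows "AE x in \<mu>. x \<in> A \<longrightarrow> p x = e * q x"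
proof -
  have "integrable P (indicator A :: _ \<Rightarrow> real)" "integrable Q (indicator A :: _ \<Rightarrow> real)"
    by (auto simp: P.emeasure_eq_measure Q.emeasure_eq_measure)
  then have i: "integrable \<mu> (\<lambda>x. p x * indicator A x)" "integrable \<mu> (\<lambda>x. q x * indicator A x)"
    unfolding P_eq[symmetric] Q_eq[symmetric]
    by (auto simp: integrable_real_density p_nonneg q_nonneg)
  have "(\<integral>x. p x * indicator A x \<partial>\<mu>) = measure P A" "(\<integral>x. q x * indicator A x \<partial>\<mu>) = measure Q A"
    by (simp_all add: P_eq[symmetric] Q_eq[symmetric] p_nonneg q_nonneg
        flip: integral_real_density)
  then have z: "(\<integral>x. e * (q x * indicator A x) - p x * indicator A x \<partial>\<mu>) = 0"
    "(\<integral>x. p x * indicator A x - e * (q x * indicator A x) \<partial>\<mu>) = 0"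
    using i A by simp_all
  from side show ?thesis
  proof
    assume "AE x in \<mu>. p x \<le> e * q x"
    then have "AE x in \<mu>. 0 \<le> e * (q x * indicator A x) - p x * indicator A x"
      by eventually_elim (auto simp: indicator_def)
    then have "AE x in \<mu>. e * (q x * indicator A x) - p x * indicator A x = 0"
      using z(1) i by (subst integral_nonneg_eq_0_iff_AE[symmetric]) auto
    then show ?thesis
      by eventually_elim (auto simp: indicator_def)
  next
    assume "AE x in \<mu>. e * q x \<le> p x"
    then have "AE x in \<mu>. 0 \<le> p x * indicator A x - e * (q x * indicator A x)"
      by eventually_elim (auto simp: indicator_def)
    then have "AE x in \<mu>. p x * indicator A x - e * (q x * indicator A x) = 0"
      using z(2) i by (subst integral_nonneg_eq_0_iff_AE[symmetric]) auto
    then show ?thesis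
      by eventually_elim (auto simp: indicator_def)
  qed
qed

end

section \<open>Monotonicity for the jumps and for the divergence\<close>

context pushed_densities
begin

text \<open>
  Let \<open>e\<close> be a jump point. On the set of \<open>y\<close> with \<open>p' y = e q' y\<close> the image measure of \<open>P\<close> is \<open>e\<close> times
  that of \<open>Q\<close>, so the same holds for \<open>P\<close> and \<open>Q\<close> on its preimage. As \<open>p - e q\<close> has constant sign, it
  vanishes almost everywhere on this preimage. Thus wherever the ratio of the images sits at a
  jump, the ratio upstairs already sits at the same jump.
\<close>

lemma nn_integral_jump_le:
  assumes f: "f \<in> csiszar_class" and nonneg: "\<And>s. 0 \<le> f s" and star0: "0 \<le> star0 f"
    and finite: "(\<integral>\<^sup>+x. perspective f (p x) (q x) \<partial>\<mu>) < \<infinity>"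
  shows "(\<integral>\<^sup>+y. ennreal (q' y) * jump f (p' y / q' y) \<partial>\<mu>')
    \<le> (\<integral>\<^sup>+x. ennreal (q x) * jump f (p x / q x) \<partial>\<mu>)"
proof -
  note [measurable] = borel_measurable_jump[OF f nonneg]
  have "AE x in \<mu>. p' (\<phi> x) = e * q' (\<phi> x) \<longrightarrow> p x = e * q x" if "e \<in> jump_points f" for e
  proof -
    note e = jump_points_one_sided[OF f nonneg that]
    define B where "B = {y \<in> space \<mu>'. p' y = e * q' y}"
    have B [measurable]: "B \<in> sets \<mu>'"
      unfolding B_def by measurable
    have "measure (distr P N \<phi>) B = (\<integral>y. p' y * indicator B y \<partial>\<mu>')"
      by (simp add: img.P_eq[symmetric] img.p_nonneg flip: integral_real_density)
    also have "\<dots> = (\<integral>y. e * (q' y * indicator B y) \<partial>\<mu>')"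
      by (intro Bochner_Integration.integral_cong) (auto simp: B_def indicator_def)
    also have "\<dots> = e * measure (distr Q N \<phi>) B"
      by (simp add: img.Q_eq[symmetric] img.q_nonneg flip: integral_real_density)
    finally have "measure (distr P N \<phi>) B = e * measure (distr Q N \<phi>) B" .
    moreover have "B \<in> sets N"
      using B by (simp add: sets_img)
    ultimately have "measure P (\<phi> -` B \<inter> space \<mu>) = e * measure Q (\<phi> -` B \<inter> space \<mu>)"
      by (subst (asm) (1 2) measure_distr) (auto simp: dom.space_P dom.space_Q)
    then have "AE x in \<mu>. x \<in> \<phi> -` B \<inter> space \<mu> \<longrightarrow> p x = e * q x"
      by (intro dom.AE_ratio_eq_of_one_sided dom.AE_ratio_one_sided[OF f star0 e(1,2) finite]) auto
    then show ?thesis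
      using measurable_space[OF \<phi>_measurable] sets_eq_imp_space_eq[OF sets_img]
      by (auto simp: B_def elim!: eventually_mono)
  qed
  then have "AE x in \<mu>. \<forall>e \<in> jump_points f. p' (\<phi> x) = e * q' (\<phi> x) \<longrightarrow> p x = e * q x"
    using finite_jump_points[OF f nonneg] by (simp add: AE_ball_countable countable_finite)
  then have touch: "AE x in Q. \<forall>e \<in> jump_points f. p' (\<phi> x) = e * q' (\<phi> x) \<longrightarrow> p x = e * q x"
    unfolding dom.Q_eq[symmetric] by (subst AE_density) (auto elim: eventually_mono)
  have le: "AE x in Q. jump f (p' (\<phi> x) / q' (\<phi> x)) \<le> jump f (p x / q x)"
    using touch dom.AE_Q_pos
  proof eventually_elim
    case (elim x)
    show ?case
    proof (cases "p' (\<phi> x) / q' (\<phi> x) \<in> jump_points f")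
      case True
      then have "q' (\<phi> x) \<noteq> 0"
        using jump_points_one_sided(1)[OF f nonneg True] by auto
      then have "p x / q x = p' (\<phi> x) / q' (\<phi> x)"
        using elim True by (auto simp: field_simps dest!: bspec[OF _ True])
      then show ?thesis by simp
    qed (simp add: jump_def)
  qed
  have "(\<integral>\<^sup>+y. ennreal (q' y) * jump f (p' y / q' y) \<partial>\<mu>')
      = (\<integral>\<^sup>+y. jump f (p' y / q' y) \<partial>distr Q N \<phi>)"
    by (simp add: img.nn_integral_Q)
  also have "\<dots> = (\<integral>\<^sup>+x. jump f (p' (\<phi> x) / q' (\<phi> x)) \<partial>Q)"
    by (rule nn_integral_distr) auto
  also have "\<dots> \<le> (\<integral>\<^sup>+x. jump f (p x / q x) \<partial>Q)"
    using le by (rule nn_integral_mono_AE)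
  finally show ?thesis
    by (simp add: dom.nn_integral_Q)
qed

lemma csiszar_div_distr_le_nonneg:
  assumes f: "f \<in> csiszar_class" and nonneg: "\<And>s. 0 \<le> f s"
  shows "csiszar_div f (distr P N \<phi>) (distr Q N \<phi>) \<le> csiszar_div f P Q"
proof -
  note [measurable] = borel_measurable_jump[OF f nonneg]
  have zero: "(0, 0) \<in> rational_minorants f"
    using nonneg by (simp add: rational_minorants_def affine_minorants_def zero_ereal_def[symmetric])
  have star0: "0 \<le> star0 f"
    unfolding star0_nonneg_eq[OF f nonneg]
    using zero by (intro SUP_upper2[of "(0, 0)"]) (auto simp: rational_minorants_def)
  note div = dom.csiszar_div_eq_perspective[OF f nonneg star0]
    img.csiszar_div_eq_perspective[OF f nonneg star0]
  have meas: "(\<lambda>x. persp_sup (rational_minorants f) (u x) (v x)) \<in> borel_measurable M"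
    if [measurable]: "u \<in> borel_measurable M" "v \<in> borel_measurable M" for u v and M :: "'z measure"
    unfolding persp_sup_def split_beta
    by (intro borel_measurable_SUP countable_rational_minorants) auto
  have "(\<integral>\<^sup>+y. perspective f (p' y) (q' y) \<partial>\<mu>') \<le> (\<integral>\<^sup>+x. perspective f (p x) (q x) \<partial>\<mu>)"
  proof (cases "(\<integral>\<^sup>+x. perspective f (p x) (q x) \<partial>\<mu>) < \<infinity>")
    case True
    have "(\<integral>\<^sup>+y. perspective f (p' y) (q' y) \<partial>\<mu>')
        = (\<integral>\<^sup>+y. persp_sup (rational_minorants f) (p' y) (q' y) \<partial>\<mu>')
          + (\<integral>\<^sup>+y. ennreal (q' y) * jump f (p' y / q' y) \<partial>\<mu>')"
      unfolding perspective_eq[OF f nonneg img.p_nonneg img.q_nonneg]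
      by (intro nn_integral_add meas) auto
    also have "\<dots> \<le> (\<integral>\<^sup>+x. persp_sup (rational_minorants f) (p x) (q x) \<partial>\<mu>)
          + (\<integral>\<^sup>+x. ennreal (q x) * jump f (p x / q x) \<partial>\<mu>)"
      using zero
      by (intro add_mono nn_integral_persp_sup_le nn_integral_jump_le[OF f nonneg star0 True]
          countable_rational_minorants)
    also have "\<dots> = (\<integral>\<^sup>+x. perspective f (p x) (q x) \<partial>\<mu>)"
      unfolding perspective_eq[OF f nonneg dom.p_nonneg dom.q_nonneg]
      by (intro nn_integral_add[symmetric] meas) auto
    finally show ?thesis .
  qed (auto simp: not_less top_unique)
  then show ?thesis
    unfolding div by (simp add: less_eq_ennreal.rep_eq)
qed

end

section \<open>Adding a multiple of t - 1\<close>

lemma csiszar_class_add_affine: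
  assumes f: "f \<in> csiszar_class"
  shows "(\<lambda>s. f s + ereal (c * (s - 1))) \<in> csiszar_class" (is "?g \<in> _")
proof -
  have dom: "effective_dom ?g = effective_dom f"
    by (auto simp: effective_dom_def)
  have distrib: "ereal u * ?g x = ereal u * f x + ereal (u * (c * (x - 1)))" for u x
    by (cases "f x") (auto simp: algebra_simps)
  have "?g (u * x + v * y) \<le> ereal u * ?g x + ereal v * ?g y"
    if uv: "0 \<le> u" "0 \<le> v" "u + v = 1" for u v x y
  proof -
    have "u * (c * (x - 1)) + v * (c * (y - 1)) = c * (u * x + v * y - (u + v))"
      by (simp add: algebra_simps)
    then have "?g (u * x + v * y) = f (u * x + v * y) + (ereal (u * (c * (x - 1))) + ereal (v * (c * (y - 1))))"
      using uv by simp
    also have "\<dots> \<le> (ereal u * f x + ereal v * f y) + (ereal (u * (c * (x - 1))) + ereal (v * (c * (y - 1))))"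
      using uv by (intro add_right_mono csiszar_class_convexD[OF f])
    also have "\<dots> = ereal u * ?g x + ereal v * ?g y"
      unfolding distrib by (simp only: ac_simps)
    finally show ?thesis .
  qed
  moreover have "(?g \<longlongrightarrow> ?g 0) (at_right 0)"
  proof (rule tendsto_add_ereal_general)
    show "(f \<longlongrightarrow> f 0) (at_right 0)"
      using f by (simp add: csiszar_class_def)
    have "((\<lambda>s. c * (s - 1)) \<longlongrightarrow> c * (0 - 1)) (at_right 0)"
      by (intro tendsto_intros)
    then show "((\<lambda>s. ereal (c * (s - 1))) \<longlongrightarrow> ereal (c * (0 - 1))) (at_right 0)"
      by simp
  qed auto
  ultimately show ?thesis
    using f dom by (auto simp: csiszar_class_def proper_convex_def)
qed

lemma star0_add_affine:
  assumes g: "g \<in> csiszar_class" and nonneg: "\<And>s. 0 \<le> g s"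
  shows "star0 (\<lambda>s. g s + ereal (c * (s - 1))) = star0 g + ereal c"
proof -
  have "((\<lambda>t. c - c / t) \<longlongrightarrow> c - 0) at_top"
    by (intro tendsto_intros tendsto_divide_0[OF tendsto_const] filterlim_at_top_imp_at_infinity
        filterlim_ident)
  then have "((\<lambda>t. ereal (c - c / t)) \<longlongrightarrow> ereal c) at_top"
    by simp
  then have "((\<lambda>t. g t / ereal t + ereal (c - c / t)) \<longlongrightarrow> star0 g + ereal c) at_top"
    using tendsto_slope_at_top[OF g nonneg] unfolding star0_nonneg_eq[OF g nonneg, symmetric]
    by (intro tendsto_add_ereal_general) auto
  moreover have "eventually (\<lambda>t. g t / ereal t + ereal (c - c / t)
      = (g t + ereal (c * (t - 1))) / ereal t) at_top"
    using eventually_gt_at_top[of "0::real"]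
  proof eventually_elim
    case (elim t)
    then show ?case
      by (cases "g t") (auto simp: field_simps)
  qed
  ultimately have "((\<lambda>t. (g t + ereal (c * (t - 1))) / ereal t) \<longlongrightarrow> star0 g + ereal c) at_top"
    by (rule Lim_transform_eventually)
  then show ?thesis
    unfolding star0_def[of "\<lambda>s. g s + ereal (c * (s - 1))"] by (intro tendsto_Lim) auto
qed

text \<open>
  The integrals of positive and negative parts satisfy an additive identity without subtraction,
  in which every term except the integrals of \<open>G\<close> and of the positive part of \<open>G + w\<close> is finite.
\<close>

lemma ereal_integral_add_integrable:
  assumes [measurable]: "G \<in> borel_measurable M" and G: "\<And>x. 0 \<le> G x"
    and w: "integrable M w"
  shows "ereal_integral M (\<lambda>x. G x + ereal (w x)) = ereal_integral M G + ereal (\<integral>x. w x \<partial>M)"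
proof -
  have [measurable]: "w \<in> borel_measurable M"
    using w by simp
  define I where "I = (\<integral>\<^sup>+x. e2ennreal (G x) \<partial>M)"
  define pos where "pos = (\<integral>\<^sup>+x. e2ennreal (G x + ereal (w x)) \<partial>M)"
  define neg where "neg = (\<integral>\<^sup>+x. e2ennreal (- (G x + ereal (w x))) \<partial>M)"
  define A where "A = (\<integral>\<^sup>+x. ennreal (w x) \<partial>M)"
  define B where "B = (\<integral>\<^sup>+x. ennreal (- w x) \<partial>M)"
  have AB: "A < top" "B < top"
    using w unfolding A_def B_def real_integrable_def by (auto simp: less_top)
  have "e2ennreal (- (G x + ereal (w x))) \<le> ennreal (- w x)" for x
    using G[of x] by (cases "G x") (auto simp: e2ennreal_neg intro!: ennreal_leI)
  then have "neg \<le> B"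
    unfolding neg_def B_def by (intro nn_integral_mono)
  then have neg: "neg < top"
    using AB(2) by (rule le_less_trans)
  have "e2ennreal (G x + ereal (w x)) + ennreal (- w x)
      = e2ennreal (G x) + ennreal (w x) + e2ennreal (- (G x + ereal (w x)))" for x
  proof (cases "G x")
    case (real r)
    then have "0 \<le> r"
      using G[of x] by simp
    then have "ennreal (r + w x) + ennreal (- w x) = ennreal r + ennreal (w x) + ennreal (- (r + w x))"
      by (cases "0 \<le> w x"; cases "0 \<le> r + w x") (auto simp: ennreal_neg simp flip: ennreal_plus)
    then show ?thesis
      by (simp add: real)
  qed (use G[of x] in auto)
  then have "(\<integral>\<^sup>+x. e2ennreal (G x + ereal (w x)) + ennreal (- w x) \<partial>M)
      = (\<integral>\<^sup>+x. e2ennreal (G x) + ennreal (w x) + e2ennreal (- (G x + ereal (w x))) \<partial>M)"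
    by simp
  then have eq: "pos + B = I + A + neg"
    unfolding pos_def B_def I_def A_def neg_def by (simp add: nn_integral_add)
  have int: "(\<integral>x. w x \<partial>M) = enn2real A - enn2real B"
    unfolding A_def B_def by (rule real_lebesgue_integral_def[OF w])
  have "enn2ereal pos - enn2ereal neg = enn2ereal I + ereal (\<integral>x. w x \<partial>M)"
    using eq AB neg unfolding int
    by (cases pos rule: ennreal_cases; cases I rule: ennreal_cases; cases A rule: ennreal_cases;
        cases B rule: ennreal_cases; cases neg rule: ennreal_cases)
      (auto simp: enn2ereal_ennreal simp flip: ennreal_plus)
  moreover have "e2ennreal (- G x) = 0" for x
    using G[of x] by (intro e2ennreal_neg) simp
  ultimately show ?thesis
    by (simp add: ereal_integral_def pos_def neg_def I_def zero_ennreal.rep_eq)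
qed

text \<open>
  The integral of \<open>p / q - 1\<close> over \<open>Q\<close> is minus the mass of the part of \<open>P\<close> singular to \<open>Q\<close>. The singular
  term makes up for this, as its factor \<open>f\<^sup>*(0)\<close> increases by the slope \<open>c\<close>.
\<close>

lemma (in prob_densities) csiszar_div_add_affine:
  assumes g: "g \<in> csiszar_class" and nonneg: "\<And>s. 0 \<le> g s"
  shows "csiszar_div (\<lambda>s. g s + ereal (c * (s - 1))) P Q = csiszar_div g P Q"
proof -
  note [measurable] = borel_measurable_csiszar_class[OF g]
  let ?h = "\<lambda>x. p x / q x" and ?S = "measure P {x \<in> space P. q x = 0}"
  let ?J = "indicator {x \<in> space P. q x \<noteq> 0} :: 'a \<Rightarrow> real"
  have sing: "q x * ?h x = p x * ?J x" if "x \<in> space \<mu>" for x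
    using that by (auto simp: space_P)
  have iJ: "integrable P ?J"
    by (auto simp: P.emeasure_eq_measure)
  then have "integrable \<mu> (\<lambda>x. p x * ?J x)"
    by (subst (asm) P_eq[symmetric], subst (asm) integrable_real_density) (auto simp: p_nonneg)
  then have "integrable \<mu> (\<lambda>x. q x * ?h x)"
    by (subst Bochner_Integration.integrable_cong[OF refl sing])
  then have h: "integrable Q ?h"
    by (subst Q_eq[symmetric], subst integrable_real_density) (auto simp: q_nonneg)
  have "(\<integral>x. ?h x \<partial>Q) = (\<integral>x. q x * ?h x \<partial>\<mu>)"
    by (subst Q_eq[symmetric], subst integral_real_density) (auto simp: q_nonneg)
  also have "\<dots> = (\<integral>x. p x * ?J x \<partial>\<mu>)"
    by (intro Bochner_Integration.integral_cong refl sing)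
  also have "\<dots> = (\<integral>x. ?J x \<partial>P)"
    by (subst (2) P_eq[symmetric], subst integral_real_density) (auto simp: p_nonneg)
  also have "\<dots> = measure P {x \<in> space P. q x \<noteq> 0}"
    by simp
  also have "\<dots> = 1 - ?S"
    using P.prob_neg[of "\<lambda>x. q x = 0"] by simp
  finally have w: "(\<integral>x. c * (?h x - 1) \<partial>Q) = - c * ?S"
    using h by (simp add: Q.prob_space)
  have "ereal_integral Q (\<lambda>x. g (?h x) + ereal (c * (?h x - 1)))
      = ereal_integral Q (\<lambda>x. g (?h x)) + ereal (\<integral>x. c * (?h x - 1) \<partial>Q)"
    using h nonneg by (intro ereal_integral_add_integrable) auto
  then have "csiszar_div (\<lambda>s. g s + ereal (c * (s - 1))) P Q
      = ereal_integral Q (\<lambda>x. g (?h x)) + ereal (- c * ?S) + (star0 g + ereal c) * ereal ?S"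
    unfolding csiszar_div_eq_real_ratio star0_add_affine[OF g nonneg] w by simp
  also have "\<dots> = ereal_integral Q (\<lambda>x. g (?h x)) + (ereal (- c * ?S) + (star0 g * ereal ?S + ereal (c * ?S)))"
    by (cases "star0 g") (auto simp: algebra_simps)
  also have "ereal (- c * ?S) + (star0 g * ereal ?S + ereal (c * ?S)) = star0 g * ereal ?S"
    by (cases "star0 g * ereal ?S") auto
  finally show ?thesis
    unfolding csiszar_div_eq_real_ratio .
qed

section \<open>Data processing\<close>

theorem csiszar_div_distr_le:
  assumes f: "f \<in> csiszar_class" and P: "prob_space P" and Q: "prob_space Q"
    and sets: "sets Q = sets P" and \<phi>: "\<phi> \<in> measurable P N"
  shows "csiszar_div f (distr P N \<phi>) (distr Q N \<phi>) \<le> csiszar_div f P Q"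
proof -
  have \<phi>Q: "\<phi> \<in> measurable Q N"
    using \<phi> by (simp add: measurable_cong_sets[OF sets refl])
  obtain \<mu> p q where d: "prob_densities \<mu> P Q p q"
    using prob_densities_exist[OF P Q sets] .
  obtain \<mu>' p' q' where d': "prob_densities \<mu>' (distr P N \<phi>) (distr Q N \<phi>) p' q'"
    using prob_densities_exist[of "distr P N \<phi>" "distr Q N \<phi>"]
      prob_space.prob_space_distr[OF P \<phi>] prob_space.prob_space_distr[OF Q \<phi>Q] by auto
  interpret pushed_densities \<mu> P Q p q \<mu>' N \<phi> p' q'
    using d d' \<phi> by (intro pushed_densities.intro pushed_densities_axioms.intro)
  obtain c where c: "\<And>s. f 1 + ereal (c * (s - 1)) \<le> f s"
    using csiszar_class_subgradient[OF f csiszar_class_at_1(3)[OF f]] by blast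
  define g where "g s = f s + ereal (- c * (s - 1))" for s
  have g: "g \<in> csiszar_class"
    unfolding g_def by (rule csiszar_class_add_affine[OF f])
  have nonneg: "0 \<le> g s" for s
    using c[of s] csiszar_class_at_1(1)[OF f] by (cases "f s") (auto simp: g_def)
  have f_eq: "f = (\<lambda>s. g s + ereal (c * (s - 1)))"
  proof
    show "f s = g s + ereal (c * (s - 1))" for s
      by (cases "f s") (auto simp: g_def)
  qed
  show ?thesis
    unfolding f_eq dom.csiszar_div_add_affine[OF g nonneg] img.csiszar_div_add_affine[OF g nonneg]
    by (rule csiszar_div_distr_le_nonneg[OF g nonneg])
qed

text \<open>
  The product of the laws of \<open>\<phi>1(X1)\<close> and \<open>\<phi>2(X2)\<close> and their joint law are the images, under one and
  the same map \<open>\<phi>1 \<times> \<phi>2\<close>, of the product of the laws and the joint law of \<open>X1\<close> and \<open>X2\<close>.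
\<close>

theorem corollary8:
  fixes M :: "'w measure"
    and \<Omega>1 :: "'a measure" and \<Omega>2 :: "'b measure"
    and \<Omega>1' :: "'c measure" and \<Omega>2' :: "'d measure"
    and X1 :: "'w \<Rightarrow> 'a" and X2 :: "'w \<Rightarrow> 'b"
    and \<phi>1 :: "'a \<Rightarrow> 'c" and \<phi>2 :: "'b \<Rightarrow> 'd"
    and f :: "real \<Rightarrow> ereal"
  assumes "prob_space M"
    and "X1 \<in> measurable M \<Omega>1" and "X2 \<in> measurable M \<Omega>2"
    and "\<phi>1 \<in> measurable \<Omega>1 \<Omega>1'" and "\<phi>2 \<in> measurable \<Omega>2 \<Omega>2'"
    and "f \<in> csiszar_class"
  shows "csiszar_index f M \<Omega>1' \<Omega>2' (\<phi>1 \<circ> X1) (\<phi>2 \<circ> X2) \<le> csiszar_index f M \<Omega>1 \<Omega>2 X1 X2"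
proof -
  interpret M: prob_space M by fact
  note [measurable] = assms(2-5)
  let ?P1 = "distr M \<Omega>1 X1" and ?P2 = "distr M \<Omega>2 X2"
  let ?Q = "distr M (\<Omega>1 \<Otimes>\<^sub>M \<Omega>2) (\<lambda>w. (X1 w, X2 w))"
  let ?\<phi> = "\<lambda>(x, y). (\<phi>1 x, \<phi>2 y)"
  interpret P: pair_prob_space ?P1 ?P2
    by (intro pair_prob_space.intro pair_sigma_finite.intro prob_space_imp_sigma_finite
        M.prob_space_distr assms)
  have "csiszar_div f (distr (?P1 \<Otimes>\<^sub>M ?P2) (\<Omega>1' \<Otimes>\<^sub>M \<Omega>2') ?\<phi>) (distr ?Q (\<Omega>1' \<Otimes>\<^sub>M \<Omega>2') ?\<phi>)
      \<le> csiszar_div f (?P1 \<Otimes>\<^sub>M ?P2) ?Q"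
    by (intro csiszar_div_distr_le assms P.prob_space_axioms M.prob_space_distr)
      (auto cong: sets_pair_measure_cong)
  also have "distr (?P1 \<Otimes>\<^sub>M ?P2) (\<Omega>1' \<Otimes>\<^sub>M \<Omega>2') ?\<phi> = distr ?P1 \<Omega>1' \<phi>1 \<Otimes>\<^sub>M distr ?P2 \<Omega>2' \<phi>2"
    by (intro pair_measure_distr[symmetric] prob_space_imp_sigma_finite P.M2.prob_space_distr) auto
  also have "\<dots> = distr M \<Omega>1' (\<phi>1 \<circ> X1) \<Otimes>\<^sub>M distr M \<Omega>2' (\<phi>2 \<circ> X2)"
    by (simp add: distr_distr)
  also have "distr ?Q (\<Omega>1' \<Otimes>\<^sub>M \<Omega>2') ?\<phi>
      = distr M (\<Omega>1' \<Otimes>\<^sub>M \<Omega>2') (\<lambda>w. ((\<phi>1 \<circ> X1) w, (\<phi>2 \<circ> X2) w))"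
    by (subst distr_distr) (auto simp: comp_def)
  finally show ?thesis
    unfolding csiszar_index_def .
qed

end
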